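(* Let $W$ be a mesoscopic mechanical kernel (with parameter $d\in\mathbb{N}$). Then $$\kappa_s=\kappa_1=\kappa_2,$$ where $\kappa_s=-\sum_{i\in\mathbb{Z}}i\,\langle\varepsilon_i\,j(\varepsilon_0,\varepsilon_1)\rangle_1$, $\kappa_1=\frac12\langle(\varepsilon_a-\varepsilon_b)\,j(\varepsilon_a,\varepsilon_b)\rangle_1$ and $\kappa_2=\frac12\langle h(\varepsilon_a,\varepsilon_b)\rangle_1$, with $a\neq b$ two neighbouring sites.
   Context: A rate kernel $W(\varepsilon_a,\varepsilon_b\,|\,\varepsilon_a-\eta,\varepsilon_b+\eta)\ge 0$ (for $\varepsilon_a,\varepsilon_b>0$, $-\varepsilon_b<\eta<\varepsilon_a$) gives the rate at which an amount $\eta$ of energy is moved from a site with energy $\varepsilon_a$ to a neighbouring site with energy $\varepsilon_b$. $W$ is a mesoscopic mechanical kernel if (i) $W(c\varepsilon_a,c\varepsilon_b|c(\varepsilon_a-\eta),c(\varepsilon_b+\eta))=c^{-1/2}W(\varepsilon_a,\varepsilon_b|\varepsilon_a-\eta,\varepsilon_b+\eta)$ for all $c>0$; (ii) $W(\varepsilon_a,\varepsilon_b|\varepsilon_a-\eta,\varepsilon_b+\eta)=W(\varepsilon_b,\varepsilon_a|\varepsilon_b+\eta,\varepsilon_a-\eta)$; (iii) for some $d\in\mathbb{N}$, $(\varepsilon_a\varepsilon_b)^{\frac d2-1}W(\varepsilon_a,\varepsilon_b|\varepsilon_a-\eta,\varepsilon_b+\eta)=((\varepsilon_a-\eta)(\varepsilon_b+\eta))^{\frac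 d2-1}W(\varepsilon_a-\eta,\varepsilon_b+\eta|\varepsilon_a,\varepsilon_b)$. $\langle\cdot\rangle_1$ is expectation when the energies $(\varepsilon_i)_{i\in\mathbb{Z}}$ are i.i.d. with density $\varepsilon^{\frac d2-1}e^{-\varepsilon}/\Gamma(d/2)$ on $(0,\infty)$ (equilibrium at temperature $1$). $j(\varepsilon_a,\varepsilon_b)=\int_{-\varepsilon_b}^{\varepsilon_a}\eta\,W(\varepsilon_a,\varepsilon_b|\varepsilon_a-\eta,\varepsilon_b+\eta)\,d\eta$ and $h(\varepsilon_a,\varepsilon_b)=\int_{-\varepsilon_b}^{\varepsilon_a}\eta^2\,W(\varepsilon_a,\varepsilon_b|\varepsilon_a-\eta,\varepsilon_b+\eta)\,d\eta$. All integrals and expectations that appear are assumed to be absolutely convergent. *)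

theory Defs
  imports "HOL-Probability.Probability"
begin

text \<open>
  A kernel is a function of four energies: \<open>W x y x' y'\<close> is the rate
  \<open>W(x, y | x', y')\<close>.  Only the values at \<open>x' = x - \<eta>\<close>, \<open>y' = y + \<eta>\<close> with \<open>x, y > 0\<close> and
  \<open>- y < \<eta> < x\<close> are meaningful, and nothing is required of the others.
\<close>

type_synonym kernel = "real \<Rightarrow> real \<Rightarrow> real \<Rightarrow> real \<Rightarrow> real"

definition exchange_domain :: "(real \<times> real \<times> real) set" where
  "exchange_domain = {(x, y, \<eta>). 0 < x \<and> 0 < y \<and> - y < \<eta> \<and> \<eta> < x}"

definition rate_kernel :: "kernel \<Rightarrow> bool" where
  "rate_kernel W \<longleftrightarrow>
     (\<lambda>(x, y, \<eta>). W x y (x - \<eta>) (y + \<eta>)) \<in> borel_measurable (restrict_space borel exchange_domain) \<and>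
     (\<forall>(x, y, \<eta>) \<in> exchange_domain. 0 \<le> W x y (x - \<eta>) (y + \<eta>))"

text \<open>
  The parameter \<open>d\<close> is positive, since otherwise the equilibrium density below is not normalisable.
\<close>

definition mesoscopic_mechanical_kernel :: "nat \<Rightarrow> kernel \<Rightarrow> bool" where
  "mesoscopic_mechanical_kernel d W \<longleftrightarrow>
     0 < d \<and> rate_kernel W \<and>
     (\<forall>(x, y, \<eta>) \<in> exchange_domain. \<forall>c > 0.
        W (c * x) (c * y) (c * (x - \<eta>)) (c * (y + \<eta>))
          = c powr (- 1 / 2) * W x y (x - \<eta>) (y + \<eta>)) \<and>
     (\<forall>(x, y, \<eta>) \<in> exchange_domain.
        W x y (x - \<eta>) (y + \<eta>) = W y x (y + \<eta>) (x - \<eta>)) \<and>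
     (\<forall>(x, y, \<eta>) \<in> exchange_domain.
        (x * y) powr (real d / 2 - 1) * W x y (x - \<eta>) (y + \<eta>)
          = ((x - \<eta>) * (y + \<eta>)) powr (real d / 2 - 1) * W (x - \<eta>) (y + \<eta>) x y)"

text \<open>
  The single-site law lives on the space \<open>{0<..}\<close>, not on all of \<open>real\<close>, so that averages never
  see the meaningless values of a kernel at non-positive energies.
\<close>

definition site_law :: "nat \<Rightarrow> real measure" where
  "site_law d = density (restrict_space lborel {0<..})
     (\<lambda>x. ennreal (x powr (real d / 2 - 1) * exp (- x) / Gamma (real d / 2)))"

definition equilibrium :: "nat \<Rightarrow> (int \<Rightarrow> real) measure" where
  "equilibrium d = (\<Pi>\<^sub>M i\<in>UNIV. site_law d)"

definition current :: "kernel \<Rightarrow> real \<Rightarrow> real \<Rightarrow> real" where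
  "current W x y = (LINT \<eta>:{- y<..<x}|lborel. \<eta> * W x y (x - \<eta>) (y + \<eta>))"

definition second_moment :: "kernel \<Rightarrow> real \<Rightarrow> real \<Rightarrow> real" where
  "second_moment W x y = (LINT \<eta>:{- y<..<x}|lborel. \<eta>\<^sup>2 * W x y (x - \<eta>) (y + \<eta>))"

definition kappa_s_term :: "nat \<Rightarrow> kernel \<Rightarrow> int \<Rightarrow> real" where
  "kappa_s_term d W i = of_int i * (\<integral>\<omega>. \<omega> i * current W (\<omega> 0) (\<omega> 1) \<partial>equilibrium d)"

definition kappa_s :: "nat \<Rightarrow> kernel \<Rightarrow> real" where
  "kappa_s d W = - (\<Sum>\<^sub>\<infinity>i\<in>UNIV. kappa_s_term d W i)"

definition kappa_1 :: "nat \<Rightarrow> kernel \<Rightarrow> int \<Rightarrow> int \<Rightarrow> real" where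
  "kappa_1 d W a b = 1 / 2 * (\<integral>\<omega>. (\<omega> a - \<omega> b) * current W (\<omega> a) (\<omega> b) \<partial>equilibrium d)"

definition kappa_2 :: "nat \<Rightarrow> kernel \<Rightarrow> int \<Rightarrow> int \<Rightarrow> real" where
  "kappa_2 d W a b = 1 / 2 * (\<integral>\<omega>. second_moment W (\<omega> a) (\<omega> b) \<partial>equilibrium d)"

text \<open>
  Absolute convergence of the average of \<open>\<integral> f \<omega> \<eta> * W (\<omega> a) (\<omega> b) (\<omega> a - \<eta>) (\<omega> b + \<eta>) d\<eta>\<close>,
  meant as a multiple integral over the configuration \<open>\<omega>\<close> and the exchanged energy \<open>\<eta>\<close>.
  Absolute convergence of the outer integral alone would allow cancellations in \<open>\<eta>\<close>, for which
  the detailed balance change of variables \<open>(x, y, \<eta>) \<mapsto> (x - \<eta>, y + \<eta>, - \<eta>)\<close> is not justified.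
\<close>

definition abs_convergent_average ::
    "nat \<Rightarrow> kernel \<Rightarrow> int \<Rightarrow> int \<Rightarrow> ((int \<Rightarrow> real) \<Rightarrow> real \<Rightarrow> real) \<Rightarrow> bool" where
  "abs_convergent_average d W a b f \<longleftrightarrow>
     set_integrable (equilibrium d \<Otimes>\<^sub>M lborel) {(\<omega>, \<eta>). - \<omega> b < \<eta> \<and> \<eta> < \<omega> a}
       (\<lambda>(\<omega>, \<eta>). f \<omega> \<eta> * W (\<omega> a) (\<omega> b) (\<omega> a - \<eta>) (\<omega> b + \<eta>))"

end

theory Submission
  imports Defs
begin

text \<open>
  The law of two distinct sites has a density, so \<open>\<kappa>\<^sub>1\<close> and \<open>\<kappa>\<^sub>2\<close> become integrals of \<open>(x - y) \<eta>\<close> and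
  \<open>\<eta>\<^sup>2\<close> over \<open>((x, y), \<eta>)\<close> against one and the same weight. By detailed balance this weight is invariant
  under the volume preserving involution \<open>((x, y), \<eta>) \<mapsto> ((x - \<eta>, y + \<eta>), - \<eta>)\<close>, which sends
  \<open>(x - y) \<eta>\<close> to \<open>2 \<eta>\<^sup>2 - (x - y) \<eta>\<close>; hence \<open>\<kappa>\<^sub>1 = \<kappa>\<^sub>2\<close>. For \<open>\<kappa>\<^sub>s\<close>, exchanging the sites \<open>0\<close> and \<open>1\<close>
  preserves the equilibrium measure and reverses the sign of the current, so only the terms of
  these two sites survive, and they are opposite to each other.
\<close>

section \<open>Density, exchange involution and rate as functions on the whole space\<close>

text \<open>The Gamma(d/2) density extended by zero, so that averages over the subspace
  \<open>{0<..}\<close> become Lebesgue integrals over the line.\<close>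

definition site_density :: "nat \<Rightarrow> real \<Rightarrow> real" where
  "site_density d x = indicator {0<..} x * (x powr (real d / 2 - 1) * exp (- x) / Gamma (real d / 2))"

text \<open>Time reversal of one exchange: the state after the transfer, together with the transfer
  that undoes it. The nesting of pairs follows the product of configuration space and
  \<eta>-line.\<close>

definition exchange_map :: "(real \<times> real) \<times> real \<Rightarrow> (real \<times> real) \<times> real" where
  "exchange_map = (\<lambda>((x, y), \<eta>). ((x - \<eta>, y + \<eta>), - \<eta>))"

text \<open>The indicator removes the meaningless values of \<open>W\<close>; integrals over
  \<open>{- y<..<x}\<close> can then run over all of the line.\<close>

definition exchange_rate :: "kernel \<Rightarrow> (real \<times> real) \<times> real \<Rightarrow> real" where
  "exchange_rate W = (\<lambda>((x, y), \<eta>).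
     indicator exchange_domain (x, y, \<eta>) * W x y (x - \<eta>) (y + \<eta>))"

text \<open>Rate of exchanges in equilibrium, per unit volume of ((x, y), \<eta>); this is the
  weight left invariant by detailed balance.\<close>

definition weighted_rate :: "nat \<Rightarrow> kernel \<Rightarrow> (real \<times> real) \<times> real \<Rightarrow> real" where
  "weighted_rate d W p = site_density d (fst (fst p)) * site_density d (snd (fst p)) * exchange_rate W p"

section \<open>Joint law of two coordinates of a product measure\<close>

text \<open>A rectangle in the coordinates a and b is a cylinder over \<open>{a, b}\<close>, whose
  probability factors; rectangles determine the product measure.\<close>

lemma distr_PiM_pair:
  assumes M: "\<And>i. i \<in> I \<Longrightarrow> prob_space (M i)" and ab: "a \<in> I" "b \<in> I" "a \<noteq> b"
  shows "distr (Pi\<^sub>M I M) (M a \<Otimes>\<^sub>M M b) (\<lambda>\<omega>. (\<omega> a, \<omega> b)) = M a \<Otimes>\<^sub>M M b"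
proof -
  interpret A: prob_space "M a" using M ab by auto
  interpret B: prob_space "M b" using M ab by auto
  have [measurable]: "(\<lambda>\<omega>. \<omega> a) \<in> measurable (Pi\<^sub>M I M) (M a)" "(\<lambda>\<omega>. \<omega> b) \<in> measurable (Pi\<^sub>M I M) (M b)"
    using ab by (auto intro: measurable_component_singleton)
  show ?thesis
  proof (rule pair_measure_eqI[symmetric])
    fix A B assume A[measurable]: "A \<in> sets (M a)" and B[measurable]: "B \<in> sets (M b)"
    have "emeasure (distr (Pi\<^sub>M I M) (M a \<Otimes>\<^sub>M M b) (\<lambda>\<omega>. (\<omega> a, \<omega> b))) (A \<times> B)
      = emeasure (Pi\<^sub>M I M) ((\<lambda>\<omega>. (\<omega> a, \<omega> b)) -` (A \<times> B) \<inter> space (Pi\<^sub>M I M))"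
      by (intro emeasure_distr) auto
    also have "(\<lambda>\<omega>. (\<omega> a, \<omega> b)) -` (A \<times> B) \<inter> space (Pi\<^sub>M I M)
      = prod_emb I M {a, b} (Pi\<^sub>E {a, b} (\<lambda>i. if i = a then A else B))"
      using ab by (auto simp: prod_emb_def space_PiM PiE_iff)
    also have "emeasure (Pi\<^sub>M I M) \<dots> = (\<Prod>i\<in>{a, b}. emeasure (M i) (if i = a then A else B))"
      using ab A B M by (intro emeasure_PiM_emb) auto
    also have "\<dots> = emeasure (M a) A * emeasure (M b) B"
      using ab by auto
    finally show "emeasure (M a) A * emeasure (M b) B =
      emeasure (distr (Pi\<^sub>M I M) (M a \<Otimes>\<^sub>M M b) (\<lambda>\<omega>. (\<omega> a, \<omega> b))) (A \<times> B)" ..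
  qed (simp_all add: A.sigma_finite_measure_axioms B.sigma_finite_measure_axioms)
qed

section \<open>The equilibrium law of one site and of two sites\<close>

lemma site_density_nonneg: "0 < d \<Longrightarrow> 0 \<le> site_density d x"
  by (auto simp: site_density_def indicator_def intro!: divide_nonneg_pos Gamma_real_pos)

lemma site_density_measurable [measurable]: "site_density d \<in> borel_measurable borel"
  unfolding site_density_def by measurable

text \<open>This is Euler's integral for Gamma(d/2), which converges at 0 because d is
  positive.\<close>

lemma nn_integral_site_density:
  assumes "0 < d" shows "(\<integral>\<^sup>+x. ennreal (site_density d x) \<partial>lborel) = 1"
proof -
  have G: "0 < Gamma (real d / 2)" using assms by (intro Gamma_real_pos) auto
  have "(\<integral>\<^sup>+x. ennreal (site_density d x) \<partial>lborel)
    = (\<integral>\<^sup>+x. ennreal (1 / Gamma (real d / 2)) *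
         ennreal (indicator {0..} x * x powr (real d / 2 - 1) / exp x) \<partial>lborel)"
  proof (rule nn_integral_cong)
    fix x :: real
    have "site_density d x = 1 / Gamma (real d / 2) * (indicator {0..} x * x powr (real d / 2 - 1) / exp x)"
    proof (cases "0 < x")
      case True
      then show ?thesis by (simp add: site_density_def exp_minus inverse_eq_divide)
    next
      case False
      \<comment> \<open>Euler's integral includes the endpoint 0, which \<open>site_density\<close>
        excludes; the integrands still agree there since \<open>0 powr _ = 0\<close>.\<close>
      then show ?thesis by (cases "x = 0") (simp_all add: site_density_def)
    qed
    also have "ennreal \<dots> = ennreal (1 / Gamma (real d / 2)) *
        ennreal (indicator {0..} x * x powr (real d / 2 - 1) / exp x)"
      by (rule ennreal_mult) (use G in simp_all)
    finally show "ennreal (site_density d x) = ennreal (1 / Gamma (real d / 2)) *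
        ennreal (indicator {0..} x * x powr (real d / 2 - 1) / exp x)" .
  qed
  also have "\<dots> = ennreal (1 / Gamma (real d / 2)) *
      (\<integral>\<^sup>+x. ennreal (indicator {0..} x * x powr (real d / 2 - 1) / exp x) \<partial>lborel)"
    by (rule nn_integral_cmult) measurable
  also have "\<dots> = ennreal (1 / Gamma (real d / 2)) * ennreal (Gamma (real d / 2))"
    using assms by (subst Gamma_conv_nn_integral_real) simp_all
  also have "\<dots> = 1" using G by (simp add: ennreal_mult[symmetric])
  finally show ?thesis .
qed

lemma sets_site_law: "sets (site_law d) = sets (restrict_space borel {0<..})"
  by (simp add: site_law_def sets_restrict_space)

lemma space_site_law [simp]: "space (site_law d) = {0<..}"
  by (simp add: site_law_def space_restrict_space)

lemma measurable_ident_site_law: "(\<lambda>x. x) \<in> measurable (site_law d) borel"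
  unfolding measurable_cong_sets[OF sets_site_law refl] by (rule measurable_restrict_space1) simp

text \<open>The site law sees a Borel set only through its part in \<open>{0<..}\<close>, and the
  indicator inside \<open>site_density\<close> makes the same cut.\<close>

lemma distr_site_law: "distr (site_law d) borel (\<lambda>x. x) = density lborel (site_density d)"
proof (rule measure_eqI)
  fix A assume "A \<in> sets (distr (site_law d) borel (\<lambda>x. x))"
  then have A [measurable]: "A \<in> sets borel" by simp
  have A': "A \<inter> {0<..} \<in> sets (restrict_space lborel {0<..})"
    by (auto simp: sets_restrict_space)
  have "emeasure (distr (site_law d) borel (\<lambda>x. x)) A = emeasure (site_law d) (A \<inter> {0<..})"
    by (subst emeasure_distr) (auto simp: measurable_ident_site_law)
  also have "\<dots> = (\<integral>\<^sup>+x. ennreal (x powr (real d / 2 - 1) * exp (- x) / Gamma (real d / 2)) *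
      indicator (A \<inter> {0<..}) x \<partial>restrict_space lborel {0<..})"
    unfolding site_law_def
    using A' by (intro emeasure_density) (auto intro!: measurable_restrict_space1)
  also have "\<dots> = (\<integral>\<^sup>+x. ennreal (site_density d x) * indicator A x \<partial>lborel)"
    by (subst nn_integral_restrict_space)
       (auto intro!: nn_integral_cong simp: site_density_def indicator_def)
  also have "\<dots> = emeasure (density lborel (site_density d)) A"
    by (intro emeasure_density[symmetric]) auto
  finally show "emeasure (distr (site_law d) borel (\<lambda>x. x)) A = emeasure (density lborel (site_density d)) A" .
qed simp

lemma prob_space_site_law:
  assumes "0 < d" shows "prob_space (site_law d)"
proof
  have "emeasure (site_law d) (space (site_law d)) = emeasure (distr (site_law d) borel (\<lambda>x. x)) UNIV"
    by (subst emeasure_distr) (auto simp: measurable_ident_site_law)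
  also have "\<dots> = 1"
    using assms by (simp add: distr_site_law emeasure_density nn_integral_site_density)
  finally show "emeasure (site_law d) (space (site_law d)) = 1" .
qed

lemma prob_space_equilibrium: "0 < d \<Longrightarrow> prob_space (equilibrium d)"
  unfolding equilibrium_def by (intro prob_space_PiM prob_space_site_law)

text \<open>Positivity holds at every configuration, not just almost surely, because the factors
  live on \<open>{0<..}\<close>. Integrands can therefore be rewritten pointwise.\<close>

lemma equilibrium_pos: "\<omega> \<in> space (equilibrium d) \<Longrightarrow> 0 < \<omega> i"
  by (auto simp: equilibrium_def space_PiM PiE_iff)

lemma equilibrium_component_measurable [measurable]: "(\<lambda>\<omega>. \<omega> i) \<in> borel_measurable (equilibrium d)"
  unfolding equilibrium_def
  using measurable_compose[OF measurable_component_singleton[of i UNIV "\<lambda>_. site_law d"]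
      measurable_ident_site_law] by simp

lemma site_density_product_measurable [measurable]:
  "(\<lambda>(x, y). ennreal (site_density d x * site_density d y)) \<in> borel_measurable borel"
  unfolding borel_prod[symmetric] by measurable

text \<open>Independence reduces the law to a product of two site laws; the push-forward of a
  product is the product of the push-forwards, and each of these has density
  \<open>site_density d\<close>.\<close>

lemma distr_equilibrium_pair:
  assumes "0 < d" "a \<noteq> b"
  shows "distr (equilibrium d) borel (\<lambda>\<omega>. (\<omega> a, \<omega> b))
    = density lborel (\<lambda>(x, y). ennreal (site_density d x * site_density d y))"
proof -
  interpret S: prob_space "site_law d" using assms by (intro prob_space_site_law)
  interpret D: prob_space "distr (site_law d) borel (\<lambda>x. x)"
    by (intro S.prob_space_distr measurable_ident_site_law)
  have [measurable]: "(\<lambda>x. x) \<in> measurable (site_law d) borel" by (rule measurable_ident_site_law)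
  have [measurable]: "(\<lambda>\<omega>. \<omega> i) \<in> measurable (equilibrium d) (site_law d)" for i
    unfolding equilibrium_def by (rule measurable_component_singleton) simp
  have pair: "(\<lambda>p. (fst p, snd p)) \<in> measurable (site_law d \<Otimes>\<^sub>M site_law d) (borel \<Otimes>\<^sub>M borel)"
    by measurable
  have "density lborel (\<lambda>(x, y). ennreal (site_density d x * site_density d y))
      = density (lborel \<Otimes>\<^sub>M lborel) (\<lambda>(x, y). ennreal (site_density d x) * ennreal (site_density d y))"
    using assms by (simp add: lborel_prod ennreal_mult site_density_nonneg)
  also have "\<dots> = density lborel (site_density d) \<Otimes>\<^sub>M density lborel (site_density d)"
    using D.sigma_finite_measure_axioms
    by (intro pair_measure_density[symmetric]) (auto simp: distr_site_law lborel.sigma_finite_measure_axioms)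
  also have "\<dots> = distr (site_law d \<Otimes>\<^sub>M site_law d) (borel \<Otimes>\<^sub>M borel) (\<lambda>(x, y). (x, y))"
    unfolding distr_site_law[symmetric]
    by (intro pair_measure_distr D.sigma_finite_measure_axioms) auto
  also have "site_law d \<Otimes>\<^sub>M site_law d
      = distr (equilibrium d) (site_law d \<Otimes>\<^sub>M site_law d) (\<lambda>\<omega>. (\<omega> a, \<omega> b))"
    using distr_PiM_pair[of UNIV "\<lambda>_. site_law d" a b] assms
    by (simp add: equilibrium_def prob_space_site_law)
  finally have "density lborel (\<lambda>(x, y). ennreal (site_density d x * site_density d y))
      = distr (equilibrium d) (borel \<Otimes>\<^sub>M borel) ((\<lambda>(x, y). (x, y)) \<circ> (\<lambda>\<omega>. (\<omega> a, \<omega> b)))"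
    by (subst (asm) distr_distr) (auto simp: split_beta' intro: pair simp del: prod.collapse)
  then show ?thesis by (simp add: comp_def borel_prod)
qed

text \<open>Adjoins the exchanged energy as a third, Lebesgue distributed coordinate, so that
  averages of \<eta>-integrals become integrals over ((x, y), \<eta>).\<close>

lemma distr_equilibrium_pair_lborel:
  assumes "0 < d" "a \<noteq> b"
  shows "distr (equilibrium d \<Otimes>\<^sub>M lborel) borel (\<lambda>(\<omega>, \<eta>). ((\<omega> a, \<omega> b), \<eta>))
    = density lborel (\<lambda>((x, y), \<eta>::real). ennreal (site_density d x * site_density d y))"
proof -
  have "distr (equilibrium d \<Otimes>\<^sub>M lborel) borel (\<lambda>(\<omega>, \<eta>). ((\<omega> a, \<omega> b), \<eta>))
     = distr (equilibrium d) borel (\<lambda>\<omega>. (\<omega> a, \<omega> b)) \<Otimes>\<^sub>M distr lborel borel (\<lambda>x::real. x)"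
    by (subst pair_measure_distr)
       (auto simp: borel_prod distr_id2 lborel.sigma_finite_measure_axioms)
  \<comment> \<open>Lebesgue measure is given the constant density 1 so that the rule for products
    of densities applies.\<close>
  also have "\<dots> = density lborel (\<lambda>(x, y). ennreal (site_density d x * site_density d y))
      \<Otimes>\<^sub>M density lborel (\<lambda>_::real. 1)"
    by (simp add: distr_equilibrium_pair[OF assms] distr_id2 density_1)
  also have "\<dots> = density (lborel \<Otimes>\<^sub>M lborel) (\<lambda>((x, y), \<eta>). ennreal (site_density d x * site_density d y) * 1)"
    by (subst pair_measure_density)
       (auto simp: density_1 lborel.sigma_finite_measure_axioms split: prod.split
          intro!: arg_cong[where f = "density _"])
  finally show ?thesis by (simp add: lborel_prod)
qed

section \<open>Volume preservation of the exchange involution\<close>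

lemma exchange_map_measurable [measurable]: "exchange_map \<in> borel_measurable borel"
  unfolding exchange_map_def split_beta' borel_prod[symmetric] by measurable

text \<open>Tonelli with \<eta> outermost: for fixed \<eta> the exchange is a mere translation in x
  and in y.\<close>

lemma nn_integral_lborel_triple:
  fixes f :: "(real \<times> real) \<times> real \<Rightarrow> ennreal"
  assumes f: "f \<in> borel_measurable borel"
  shows "(\<integral>\<^sup>+p. f p \<partial>lborel) = (\<integral>\<^sup>+\<eta>. \<integral>\<^sup>+x. \<integral>\<^sup>+y. f ((x, y), \<eta>) \<partial>lborel \<partial>lborel \<partial>lborel)"
proof -
  have [measurable]: "f \<in> borel_measurable ((borel \<Otimes>\<^sub>M borel) \<Otimes>\<^sub>M borel)"
    using f by (simp add: borel_prod)
  have "(\<integral>\<^sup>+p. f p \<partial>lborel) = (\<integral>\<^sup>+\<eta>. \<integral>\<^sup>+q. f (q, \<eta>) \<partial>(lborel \<Otimes>\<^sub>M lborel) \<partial>lborel)"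
    by (subst pair_sigma_finite.nn_integral_snd)
       (auto simp: lborel_prod f intro!: pair_sigma_finite.intro lborel.sigma_finite_measure_axioms)
  also have "\<dots> = (\<integral>\<^sup>+\<eta>. \<integral>\<^sup>+x. \<integral>\<^sup>+y. f ((x, y), \<eta>) \<partial>lborel \<partial>lborel \<partial>lborel)"
    by (intro nn_integral_cong, subst lborel.nn_integral_fst[symmetric]) auto
  finally show ?thesis .
qed

text \<open>The map is undone by a shift of y, a shift of x and finally a reflection of \<eta>, each
  of which preserves Lebesgue measure.\<close>

lemma nn_integral_exchange_map:
  fixes f :: "(real \<times> real) \<times> real \<Rightarrow> ennreal"
  assumes f: "f \<in> borel_measurable borel"
  shows "(\<integral>\<^sup>+p. f (exchange_map p) \<partial>lborel) = (\<integral>\<^sup>+p. f p \<partial>lborel)"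
proof -
  have [measurable]: "f \<in> borel_measurable ((borel \<Otimes>\<^sub>M borel) \<Otimes>\<^sub>M borel)"
    using f by (simp add: borel_prod)
  have shift: "(\<integral>\<^sup>+x. g (x + t) \<partial>lborel) = (\<integral>\<^sup>+x. g x \<partial>lborel)"
    if "g \<in> borel_measurable borel" for g :: "real \<Rightarrow> ennreal" and t
    using nn_integral_real_affine[of g 1 t] that by (simp add: add.commute)
  have flip: "(\<integral>\<^sup>+x. g (- x) \<partial>lborel) = (\<integral>\<^sup>+x. g x \<partial>lborel)"
    if "g \<in> borel_measurable borel" for g :: "real \<Rightarrow> ennreal"
    using nn_integral_real_affine[of g "- 1" 0] that by simp
  have "(\<integral>\<^sup>+p. f (exchange_map p) \<partial>lborel)
      = (\<integral>\<^sup>+\<eta>. \<integral>\<^sup>+x. \<integral>\<^sup>+y. f ((x - \<eta>, y + \<eta>), - \<eta>) \<partial>lborel \<partial>lborel \<partial>lborel)"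
    using nn_integral_lborel_triple[OF measurable_compose[OF exchange_map_measurable f]]
    by (simp add: exchange_map_def)
  also have "\<dots> = (\<integral>\<^sup>+\<eta>. \<integral>\<^sup>+x. \<integral>\<^sup>+y. f ((x - \<eta>, y), - \<eta>) \<partial>lborel \<partial>lborel \<partial>lborel)"
    by (intro nn_integral_cong shift) measurable
  also have "\<dots> = (\<integral>\<^sup>+\<eta>. \<integral>\<^sup>+x. \<integral>\<^sup>+y. f ((x, y), - \<eta>) \<partial>lborel \<partial>lborel \<partial>lborel)"
  proof (rule nn_integral_cong)
    fix \<eta> :: real
    \<comment> \<open>The function translated in x is now the inner integral over y, so its
      measurability has to be supplied.\<close>
    have "(\<lambda>x. \<integral>\<^sup>+y. f ((x, y), - \<eta>) \<partial>lborel) \<in> borel_measurable borel"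
      by measurable
    from shift[OF this, of "- \<eta>"] show "(\<integral>\<^sup>+x. \<integral>\<^sup>+y. f ((x - \<eta>, y), - \<eta>) \<partial>lborel \<partial>lborel)
        = (\<integral>\<^sup>+x. \<integral>\<^sup>+y. f ((x, y), - \<eta>) \<partial>lborel \<partial>lborel)"
      by simp
  qed
  also have "\<dots> = (\<integral>\<^sup>+\<eta>. \<integral>\<^sup>+x. \<integral>\<^sup>+y. f ((x, y), \<eta>) \<partial>lborel \<partial>lborel \<partial>lborel)"
    by (rule flip) measurable
  also have "\<dots> = (\<integral>\<^sup>+p. f p \<partial>lborel)"
    by (rule nn_integral_lborel_triple[OF f, symmetric])
  finally show ?thesis .
qed

text \<open>The nonnegative identity is applied to indicators; as an invariance of the measure it
  carries over to functions with a sign.\<close>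

lemma distr_exchange_map: "distr lborel borel exchange_map = lborel"
proof (rule measure_eqI)
  fix A assume "A \<in> sets (distr lborel borel exchange_map)"
  then have [measurable]: "A \<in> sets borel" by simp
  have "emeasure (distr lborel borel exchange_map) A
      = (\<integral>\<^sup>+p. indicator A p \<partial>distr lborel borel exchange_map)"
    by simp
  also have "\<dots> = (\<integral>\<^sup>+p. indicator A (exchange_map p) \<partial>lborel)"
    by (rule nn_integral_distr) auto
  also have "\<dots> = (\<integral>\<^sup>+p. indicator A p \<partial>lborel)"
    by (rule nn_integral_exchange_map) auto
  also have "\<dots> = emeasure lborel A"
    by simp
  finally show "emeasure (distr lborel borel exchange_map) A = emeasure lborel A" .
qed simp

lemma integral_exchange_map:
  fixes f :: "(real \<times> real) \<times> real \<Rightarrow> real"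
  assumes [measurable]: "f \<in> borel_measurable borel"
  shows "(\<integral>p. f (exchange_map p) \<partial>lborel) = (\<integral>p. f p \<partial>lborel)"
  by (subst (2) distr_exchange_map[symmetric], subst integral_distr) auto

section \<open>Measurability and symmetries of the rate\<close>

text \<open>The domain is open, hence Borel, so extension by zero turns measurability on the
  restricted space into measurability everywhere.\<close>

lemma exchange_rate_measurable [measurable]:
  assumes "rate_kernel W" shows "exchange_rate W \<in> borel_measurable borel"
proof -
  have "open {p::real \<times> real \<times> real. 0 < fst p \<and> 0 < fst (snd p) \<and>
      - fst (snd p) < snd (snd p) \<and> snd (snd p) < fst p}"
    by (intro open_Collect_conj open_Collect_less continuous_intros)
  then have "exchange_domain \<in> sets borel"
    by (simp add: exchange_domain_def split_beta')
  then have "(\<lambda>p. indicator exchange_domain p *\<^sub>R (case p of (x, y, \<eta>) \<Rightarrow> W x y (x - \<eta>) (y + \<eta>))) \<in> borel_measurable borel"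
    using assms by (subst borel_measurable_restrict_space_iff[symmetric]) (auto simp: rate_kernel_def)
  \<comment> \<open>The composition only reassociates ((x, y), \<eta>) into (x, y, \<eta>).\<close>
  then have "(\<lambda>p. indicator exchange_domain p *\<^sub>R (case p of (x, y, \<eta>) \<Rightarrow> W x y (x - \<eta>) (y + \<eta>)))
      \<circ> (\<lambda>p. (fst (fst p), snd (fst p), snd p)) \<in> borel_measurable borel"
    by (rule measurable_comp[rotated]) (auto intro!: borel_measurable_continuous_onI continuous_intros)
  then show ?thesis
    by (simp add: exchange_rate_def split_beta' comp_def)
qed

text \<open>Condition (iii) balances the powers, and conservation of x + y balances the
  exponentials. Membership in \<open>exchange_domain\<close> means that all four energies, before
  and after, are positive; reversal respects this, so outside the domain both sides vanish.\<close>

lemma exchange_rate_detailed_balance: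
  assumes "mesoscopic_mechanical_kernel d W"
  shows "site_density d (x - \<eta>) * site_density d (y + \<eta>) * exchange_rate W ((x - \<eta>, y + \<eta>), - \<eta>)
    = site_density d x * site_density d y * exchange_rate W ((x, y), \<eta>)"
proof (cases "(x, y, \<eta>) \<in> exchange_domain")
  case True
  then have pos: "0 < x" "0 < y" "0 < x - \<eta>" "0 < y + \<eta>"
    and dom: "(x - \<eta>, y + \<eta>, - \<eta>) \<in> exchange_domain"
    by (auto simp: exchange_domain_def)
  let ?G = "Gamma (real d / 2)"
  have "(x * y) powr (real d / 2 - 1) * W x y (x - \<eta>) (y + \<eta>)
      = ((x - \<eta>) * (y + \<eta>)) powr (real d / 2 - 1) * W (x - \<eta>) (y + \<eta>) x y"
    using assms True unfolding mesoscopic_mechanical_kernel_def by blast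
  then have db: "x powr (real d / 2 - 1) * y powr (real d / 2 - 1) * W x y (x - \<eta>) (y + \<eta>)
      = (x - \<eta>) powr (real d / 2 - 1) * (y + \<eta>) powr (real d / 2 - 1) * W (x - \<eta>) (y + \<eta>) x y"
    using pos by (simp add: powr_mult)
  have ex: "exp (- (x - \<eta>)) * exp (- (y + \<eta>)) = exp (- x) * exp (- y)"
    by (simp flip: exp_add)
  have "site_density d (x - \<eta>) * site_density d (y + \<eta>) * exchange_rate W ((x - \<eta>, y + \<eta>), - \<eta>)
      = ((x - \<eta>) powr (real d / 2 - 1) * (y + \<eta>) powr (real d / 2 - 1) * W (x - \<eta>) (y + \<eta>) x y)
        * (exp (- (x - \<eta>)) * exp (- (y + \<eta>))) / (?G * ?G)"
    using pos dom by (simp add: site_density_def exchange_rate_def)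
  also have "\<dots> = (x powr (real d / 2 - 1) * y powr (real d / 2 - 1) * W x y (x - \<eta>) (y + \<eta>))
        * (exp (- x) * exp (- y)) / (?G * ?G)"
    unfolding db ex ..
  also have "\<dots> = site_density d x * site_density d y * exchange_rate W ((x, y), \<eta>)"
    using pos True by (simp add: site_density_def exchange_rate_def)
  finally show ?thesis .
next
  case False
  then have "(x - \<eta>, y + \<eta>, - \<eta>) \<notin> exchange_domain \<or> x \<le> 0 \<or> y \<le> 0"
    by (auto simp: exchange_domain_def)
  moreover have "(x - \<eta>, y + \<eta>, - \<eta>) \<in> exchange_domain \<Longrightarrow> x > 0 \<and> y > 0"
    by (auto simp: exchange_domain_def)
  ultimately have "(x - \<eta>, y + \<eta>, - \<eta>) \<notin> exchange_domain"
    by auto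
  then show ?thesis using False by (simp add: exchange_rate_def)
qed

text \<open>Mirror symmetry (ii): relabelling the two sites reverses the direction of the
  transfer.\<close>

lemma exchange_rate_swap:
  assumes "mesoscopic_mechanical_kernel d W"
  shows "exchange_rate W ((y, x), - \<eta>) = exchange_rate W ((x, y), \<eta>)"
proof (cases "(x, y, \<eta>) \<in> exchange_domain")
  case True
  then have "(y, x, - \<eta>) \<in> exchange_domain" by (auto simp: exchange_domain_def)
  moreover have "W x y (x - \<eta>) (y + \<eta>) = W y x (y + \<eta>) (x - \<eta>)"
    using assms True unfolding mesoscopic_mechanical_kernel_def by blast
  ultimately show ?thesis using True by (simp add: exchange_rate_def)
next
  case False
  then have "(y, x, - \<eta>) \<notin> exchange_domain" by (auto simp: exchange_domain_def)
  then show ?thesis using False by (simp add: exchange_rate_def)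
qed

lemma current_eq_exchange_rate:
  assumes "0 < x" "0 < y"
  shows "current W x y = (\<integral>\<eta>. \<eta> * exchange_rate W ((x, y), \<eta>) \<partial>lborel)"
  using assms unfolding current_def set_lebesgue_integral_def
  by (intro Bochner_Integration.integral_cong) (auto simp: exchange_rate_def exchange_domain_def indicator_def)

lemma second_moment_eq_exchange_rate:
  assumes "0 < x" "0 < y"
  shows "second_moment W x y = (\<integral>\<eta>. \<eta>\<^sup>2 * exchange_rate W ((x, y), \<eta>) \<partial>lborel)"
  using assms unfolding second_moment_def set_lebesgue_integral_def
  by (intro Bochner_Integration.integral_cong) (auto simp: exchange_rate_def exchange_domain_def indicator_def)

text \<open>Substituting - \<eta> for \<eta> and applying the mirror symmetry leaves only the sign
  of the factor \<eta>.\<close>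

lemma current_antisym:
  assumes "mesoscopic_mechanical_kernel d W" "0 < x" "0 < y"
  shows "current W y x = - current W x y"
proof -
  have "current W y x = (\<integral>\<eta>. \<eta> * exchange_rate W ((y, x), \<eta>) \<partial>lborel)"
    using assms by (simp add: current_eq_exchange_rate)
  also have "\<dots> = (\<integral>\<eta>. - \<eta> * exchange_rate W ((y, x), - \<eta>) \<partial>lborel)"
    by (subst lborel_integral_real_affine[where c = "- 1" and t = 0]) auto
  also have "\<dots> = - current W x y"
    using assms by (simp add: exchange_rate_swap current_eq_exchange_rate)
  finally show ?thesis .
qed

section \<open>Equilibrium averages as Lebesgue integrals\<close>

text \<open>Since all energies are positive, the cut-off in \<open>exchange_rate\<close> coincides
  with the \<eta>-range of the definition.\<close>

lemma abs_convergent_average_iff: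
  "abs_convergent_average d W a b f \<longleftrightarrow>
    integrable (equilibrium d \<Otimes>\<^sub>M lborel) (\<lambda>(\<omega>, \<eta>). f \<omega> \<eta> * exchange_rate W ((\<omega> a, \<omega> b), \<eta>))"
  unfolding abs_convergent_average_def set_integrable_def
  by (intro Bochner_Integration.integrable_cong refl)
     (auto simp: space_pair_measure exchange_rate_def exchange_domain_def indicator_def equilibrium_pos
       split: prod.split)

text \<open>All factors of the product measure are equal, so permuting the sites does not change
  it.\<close>

lemma equilibrium_swap:
  fixes f :: "(int \<Rightarrow> real) \<Rightarrow> real"
  assumes "0 < d" "integrable (equilibrium d) f"
  shows "(\<integral>\<omega>. f (\<omega> \<circ> Transposition.transpose a b) \<partial>equilibrium d) = (\<integral>\<omega>. f \<omega> \<partial>equilibrium d)"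
proof -
  let ?t = "Transposition.transpose a b"
  have D: "distr (equilibrium d) (equilibrium d) (\<lambda>\<omega>. \<omega> \<circ> ?t) = equilibrium d"
    using distr_PiM_reindex[of UNIV "\<lambda>_. site_law d" ?t UNIV] prob_space_site_law[OF assms(1)]
    by (simp add: equilibrium_def comp_def restrict_UNIV)
  have [measurable]: "(\<lambda>\<omega>. \<omega> \<circ> ?t) \<in> measurable (equilibrium d) (equilibrium d)"
    unfolding equilibrium_def comp_def
    by (rule measurable_PiM_single') (auto simp: space_PiM PiE_iff intro!: measurable_component_singleton)
  have [measurable]: "f \<in> borel_measurable (equilibrium d)" using assms by auto
  show ?thesis
    by (subst (2) D[symmetric], subst integral_distr) auto
qed

text \<open>Fubini merges the two integrals, the push-forward keeps only ((x, y), \<eta>), and the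
  density of the pair joins the rate to form \<open>weighted_rate\<close>. The resulting integral no
  longer mentions the sites.\<close>

lemma equilibrium_average:
  fixes F :: "(real \<times> real) \<times> real \<Rightarrow> real"
  assumes W: "mesoscopic_mechanical_kernel d W" and ab: "a \<noteq> b"
    and F [measurable]: "F \<in> borel_measurable borel"
    and int: "integrable (equilibrium d \<Otimes>\<^sub>M lborel)
      (\<lambda>(\<omega>, \<eta>). F ((\<omega> a, \<omega> b), \<eta>) * exchange_rate W ((\<omega> a, \<omega> b), \<eta>))"
  shows "integrable lborel (\<lambda>p. weighted_rate d W p * F p)"
    and "(\<integral>\<omega>. \<integral>\<eta>. F ((\<omega> a, \<omega> b), \<eta>) * exchange_rate W ((\<omega> a, \<omega> b), \<eta>) \<partial>lborel \<partial>equilibrium d)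
      = (\<integral>p. weighted_rate d W p * F p \<partial>lborel)"
proof -
  have d: "0 < d" and W' [measurable]: "exchange_rate W \<in> borel_measurable borel"
    using W by (auto simp: mesoscopic_mechanical_kernel_def exchange_rate_measurable)
  interpret E: prob_space "equilibrium d" using d by (rule prob_space_equilibrium)
  interpret pair_sigma_finite "equilibrium d" lborel ..
  let ?\<phi> = "\<lambda>(\<omega>, \<eta>). ((\<omega> a, \<omega> b), \<eta>::real)"
  let ?w = "\<lambda>p::(real \<times> real) \<times> real. site_density d (fst (fst p)) * site_density d (snd (fst p))"
  let ?G = "\<lambda>p. F p * exchange_rate W p"
  have \<phi> [measurable]: "?\<phi> \<in> borel_measurable (equilibrium d \<Otimes>\<^sub>M lborel)"
    unfolding borel_prod[symmetric] by measurable
  have w [measurable]: "?w \<in> borel_measurable borel"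
    unfolding borel_prod[symmetric] by measurable
  have D: "distr (equilibrium d \<Otimes>\<^sub>M lborel) borel ?\<phi> = density lborel ?w"
    unfolding distr_equilibrium_pair_lborel[OF d ab] by (simp add: split_beta')
  have w0: "0 \<le> ?w p" for p using d by (simp add: site_density_nonneg)
  have wG: "?w p *\<^sub>R ?G p = weighted_rate d W p * F p" for p
    by (simp add: weighted_rate_def)
  have int': "integrable (equilibrium d \<Otimes>\<^sub>M lborel) (\<lambda>p. ?G (?\<phi> p))"
    using int by (simp add: split_beta')
  then have "integrable (density lborel ?w) ?G"
    unfolding D[symmetric] by (subst integrable_distr_eq) auto
  then have "integrable lborel (\<lambda>p. ?w p *\<^sub>R ?G p)"
    using w0 by (subst (asm) integrable_density) auto
  then show "integrable lborel (\<lambda>p. weighted_rate d W p * F p)"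
    unfolding wG .
  \<comment> \<open>Joint integrability in \<omega> and \<eta> is what justifies Fubini
    here.\<close>
  have "(\<integral>\<omega>. \<integral>\<eta>. ?G ((\<omega> a, \<omega> b), \<eta>) \<partial>lborel \<partial>equilibrium d)
      = (\<integral>p. ?G (?\<phi> p) \<partial>(equilibrium d \<Otimes>\<^sub>M lborel))"
    using integral_fst'[OF int'] by simp
  also have "\<dots> = (\<integral>p. ?G p \<partial>distr (equilibrium d \<Otimes>\<^sub>M lborel) borel ?\<phi>)"
    by (rule integral_distr[symmetric]) auto
  also have "\<dots> = (\<integral>p. ?w p *\<^sub>R ?G p \<partial>lborel)"
    unfolding D using w0 by (intro integral_density) auto
  finally show "(\<integral>\<omega>. \<integral>\<eta>. ?G ((\<omega> a, \<omega> b), \<eta>) \<partial>lborel \<partial>equilibrium d)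
      = (\<integral>p. weighted_rate d W p * F p \<partial>lborel)"
    unfolding wG .
qed

lemma weighted_rate_exchange_map:
  assumes "mesoscopic_mechanical_kernel d W"
  shows "weighted_rate d W (exchange_map p) = weighted_rate d W p"
proof -
  obtain x y \<eta> where "p = ((x, y), \<eta>)" by (metis surj_pair)
  then show ?thesis
    using exchange_rate_detailed_balance[OF assms] by (simp add: weighted_rate_def exchange_map_def)
qed

section \<open>The equality of \<open>kappa_1\<close> and \<open>kappa_2\<close>\<close>

text \<open>Besides preparing the comparison with \<open>kappa_2\<close>, this shows that the value
  is the same for every pair of distinct sites satisfying the convergence condition.\<close>

lemma kappa_1_eq:
  fixes d W
  defines "f \<equiv> \<lambda>p. weighted_rate d W p * ((fst (fst p) - snd (fst p)) * snd p)"
  assumes W: "mesoscopic_mechanical_kernel d W" and ab: "a \<noteq> b"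
    and conv: "abs_convergent_average d W a b (\<lambda>\<omega> \<eta>. (\<omega> a - \<omega> b) * \<eta>)"
  shows "integrable lborel f" and "kappa_1 d W a b = 1 / 2 * (\<integral>p. f p \<partial>lborel)"
proof -
  let ?F = "\<lambda>p::(real \<times> real) \<times> real. (fst (fst p) - snd (fst p)) * snd p"
  have F: "?F \<in> borel_measurable borel"
    unfolding borel_prod[symmetric] by measurable
  have int: "integrable (equilibrium d \<Otimes>\<^sub>M lborel)
      (\<lambda>(\<omega>, \<eta>). ?F ((\<omega> a, \<omega> b), \<eta>) * exchange_rate W ((\<omega> a, \<omega> b), \<eta>))"
    using conv by (simp add: abs_convergent_average_iff)
  note average = equilibrium_average[OF W ab F int]
  show "integrable lborel f"
    unfolding f_def by (rule average)
  have "(\<integral>\<omega>. (\<omega> a - \<omega> b) * current W (\<omega> a) (\<omega> b) \<partial>equilibrium d)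
      = (\<integral>\<omega>. \<integral>\<eta>. ?F ((\<omega> a, \<omega> b), \<eta>) * exchange_rate W ((\<omega> a, \<omega> b), \<eta>) \<partial>lborel \<partial>equilibrium d)"
    by (intro Bochner_Integration.integral_cong)
       (simp_all add: current_eq_exchange_rate equilibrium_pos mult.assoc)
  also have "\<dots> = (\<integral>p. f p \<partial>lborel)"
    unfolding f_def by (rule average)
  finally show "kappa_1 d W a b = 1 / 2 * (\<integral>p. f p \<partial>lborel)"
    unfolding kappa_1_def by (simp only:)
qed

lemma kappa_2_eq:
  fixes d W
  defines "f \<equiv> \<lambda>p. weighted_rate d W p * (snd p)\<^sup>2"
  assumes W: "mesoscopic_mechanical_kernel d W" and ab: "a \<noteq> b"
    and conv: "abs_convergent_average d W a b (\<lambda>\<omega> \<eta>. \<eta>\<^sup>2)"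
  shows "integrable lborel f" and "kappa_2 d W a b = 1 / 2 * (\<integral>p. f p \<partial>lborel)"
proof -
  let ?F = "\<lambda>p::(real \<times> real) \<times> real. (snd p)\<^sup>2"
  have F: "?F \<in> borel_measurable borel"
    unfolding borel_prod[symmetric] by measurable
  have int: "integrable (equilibrium d \<Otimes>\<^sub>M lborel)
      (\<lambda>(\<omega>, \<eta>). ?F ((\<omega> a, \<omega> b), \<eta>) * exchange_rate W ((\<omega> a, \<omega> b), \<eta>))"
    using conv by (simp add: abs_convergent_average_iff)
  note average = equilibrium_average[OF W ab F int]
  show "integrable lborel f"
    unfolding f_def by (rule average)
  have "(\<integral>\<omega>. second_moment W (\<omega> a) (\<omega> b) \<partial>equilibrium d)
      = (\<integral>\<omega>. \<integral>\<eta>. ?F ((\<omega> a, \<omega> b), \<eta>) * exchange_rate W ((\<omega> a, \<omega> b), \<eta>) \<partial>lborel \<partial>equilibrium d)"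
    by (intro Bochner_Integration.integral_cong)
       (simp_all add: second_moment_eq_exchange_rate equilibrium_pos)
  also have "\<dots> = (\<integral>p. f p \<partial>lborel)"
    unfolding f_def by (rule average)
  finally show "kappa_2 d W a b = 1 / 2 * (\<integral>p. f p \<partial>lborel)"
    unfolding kappa_2_def by (simp only:)
qed

lemma kappa_1_eq_kappa_2:
  assumes W: "mesoscopic_mechanical_kernel d W" and ab: "a \<noteq> b"
    and conv_1: "abs_convergent_average d W a b (\<lambda>\<omega> \<eta>. (\<omega> a - \<omega> b) * \<eta>)"
    and conv_2: "abs_convergent_average d W a b (\<lambda>\<omega> \<eta>. \<eta>\<^sup>2)"
  shows "kappa_1 d W a b = kappa_2 d W a b"
proof -
  define f where "f p = weighted_rate d W p * ((fst (fst p) - snd (fst p)) * snd p)" for p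
  define g where "g p = weighted_rate d W p * (snd p)\<^sup>2" for p
  have f: "integrable lborel f" "kappa_1 d W a b = 1 / 2 * (\<integral>p. f p \<partial>lborel)"
    unfolding f_def by (fact kappa_1_eq[OF W ab conv_1])+
  have g: "integrable lborel g" "kappa_2 d W a b = 1 / 2 * (\<integral>p. g p \<partial>lborel)"
    unfolding g_def by (fact kappa_2_eq[OF W ab conv_2])+
  \<comment> \<open>After the exchange the energy difference is x - y - 2 \<eta>, and it is
    multiplied by - \<eta>.\<close>
  have fg: "f (exchange_map p) = 2 * g p - f p" for p
    unfolding f_def g_def weighted_rate_exchange_map[OF W]
    by (simp add: exchange_map_def split_beta' algebra_simps power2_eq_square)
  have "(\<integral>p. f p \<partial>lborel) = (\<integral>p. f (exchange_map p) \<partial>lborel)"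
    using f(1) by (intro integral_exchange_map[symmetric]) auto
  \<comment> \<open>Separate integrability of \<open>f\<close> and \<open>g\<close> allows the
    integral to be split; the relation is then solved for the integral of \<open>f\<close>.\<close>
  also have "\<dots> = 2 * (\<integral>p. g p \<partial>lborel) - (\<integral>p. f p \<partial>lborel)"
    unfolding fg using f(1) g(1) by simp
  finally show ?thesis using f(2) g(2) by simp
qed

section \<open>The static sum \<open>kappa_s\<close>\<close>

text \<open>By Fubini, joint absolute convergence in \<omega> and \<eta> passes to the outer
  integral.\<close>

lemma integrable_energy_current:
  assumes "0 < d" "abs_convergent_average d W a b (\<lambda>\<omega> \<eta>. \<omega> i * \<eta>)"
  shows "integrable (equilibrium d) (\<lambda>\<omega>. \<omega> i * current W (\<omega> a) (\<omega> b))"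
proof -
  interpret E: prob_space "equilibrium d" using assms by (intro prob_space_equilibrium)
  interpret pair_sigma_finite "equilibrium d" lborel ..
  have "integrable (equilibrium d) (\<lambda>\<omega>. \<integral>\<eta>. \<omega> i * \<eta> * exchange_rate W ((\<omega> a, \<omega> b), \<eta>) \<partial>lborel)"
    using integrable_fst'[OF assms(2)[unfolded abs_convergent_average_iff]] by simp
  also have "?this \<longleftrightarrow> ?thesis"
    by (intro Bochner_Integration.integrable_cong refl)
       (simp add: current_eq_exchange_rate equilibrium_pos mult.assoc)
  finally show ?thesis .
qed

text \<open>Exchanging a and b preserves equilibrium, moves the observed site by the transposition
  and swaps the arguments of the current, which costs a sign.\<close>

lemma energy_current_swap:
  assumes W: "mesoscopic_mechanical_kernel d W"
    and conv: "abs_convergent_average d W a b (\<lambda>\<omega> \<eta>. \<omega> i * \<eta>)"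
  shows "(\<integral>\<omega>. \<omega> (Transposition.transpose a b i) * current W (\<omega> a) (\<omega> b) \<partial>equilibrium d)
    = - (\<integral>\<omega>. \<omega> i * current W (\<omega> a) (\<omega> b) \<partial>equilibrium d)"
proof -
  have d: "0 < d" using W by (simp add: mesoscopic_mechanical_kernel_def)
  have "(\<integral>\<omega>. \<omega> i * current W (\<omega> a) (\<omega> b) \<partial>equilibrium d)
      = (\<integral>\<omega>. \<omega> (Transposition.transpose a b i) * current W (\<omega> b) (\<omega> a) \<partial>equilibrium d)"
    using equilibrium_swap[OF d integrable_energy_current[OF d conv], of a b] by simp
  also have "\<dots> = (\<integral>\<omega>. - (\<omega> (Transposition.transpose a b i) * current W (\<omega> a) (\<omega> b)) \<partial>equilibrium d)"
    by (intro Bochner_Integration.integral_cong refl)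
       (simp add: current_antisym[OF W equilibrium_pos[of _ _ a] equilibrium_pos[of _ _ b]])
  finally show ?thesis by simp
qed

lemma kappa_s_eq_kappa_1:
  assumes W: "mesoscopic_mechanical_kernel d W"
    and conv: "\<And>i. abs_convergent_average d W 0 1 (\<lambda>\<omega> \<eta>. \<omega> i * \<eta>)"
  shows "kappa_s_term d W summable_on UNIV" and "kappa_s d W = kappa_1 d W 0 1"
proof -
  define E where "E i = (\<integral>\<omega>. \<omega> i * current W (\<omega> 0) (\<omega> 1) \<partial>equilibrium d)" for i :: int
  have d: "0 < d" using W by (simp add: mesoscopic_mechanical_kernel_def)
  have swap: "E (Transposition.transpose 0 1 i) = - E i" for i
    unfolding E_def by (rule energy_current_swap[OF W conv])
  \<comment> \<open>Sites other than 0 and 1 are fixed by the transposition, so \<open>E i\<close>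
    equals its own negative.\<close>
  have E0: "E i = 0" if "i \<noteq> 0" "i \<noteq> 1" for i
    using swap[of i] that by simp
  have E1: "E 1 = - E 0"
    using swap[of 0] by simp
  have term_eq: "kappa_s_term d W i = of_int i * E i" for i
    by (simp add: kappa_s_term_def E_def)
  \<comment> \<open>At i = 0 it is the prefactor i that vanishes, not \<open>E 0\<close>; the series
    thus reduces to its term at 1.\<close>
  have zero: "kappa_s_term d W i = 0" if "i \<noteq> 1" for i
    using that E0[of i] by (cases "i = 0") (auto simp: term_eq)
  have "kappa_s_term d W summable_on UNIV \<longleftrightarrow> kappa_s_term d W summable_on {1}"
    by (rule summable_on_cong_neutral) (auto simp: zero)
  then show "kappa_s_term d W summable_on UNIV" by simp
  have "(\<Sum>\<^sub>\<infinity>i\<in>UNIV. kappa_s_term d W i) = (\<Sum>\<^sub>\<infinity>i\<in>{1}. kappa_s_term d W i)"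
    by (rule infsum_cong_neutral) (auto simp: zero)
  then have "kappa_s d W = - E 1"
    by (simp add: kappa_s_def term_eq)
  \<comment> \<open>Antisymmetry distributes the single surviving term evenly over both sites, which
    produces the factor 1/2 of \<open>kappa_1\<close>.\<close>
  also have "\<dots> = 1 / 2 * (E 0 - E 1)"
    by (simp add: E1)
  also have "\<dots> = kappa_1 d W 0 1"
    unfolding E_def kappa_1_def
    by (simp add: left_diff_distrib integrable_energy_current[OF d conv])
  finally show "kappa_s d W = kappa_1 d W 0 1" .
qed

theorem proposition4p1:
  fixes W :: kernel and d :: nat and a b :: int
  assumes kernel: "mesoscopic_mechanical_kernel d W"
    and neighbours: "\<bar>a - b\<bar> = 1"
    and conv_current: "\<And>x y. 0 < x \<Longrightarrow> 0 < y \<Longrightarrow>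
          set_integrable lborel {- y<..<x} (\<lambda>\<eta>. \<eta> * W x y (x - \<eta>) (y + \<eta>))"
    and conv_second_moment: "\<And>x y. 0 < x \<Longrightarrow> 0 < y \<Longrightarrow>
          set_integrable lborel {- y<..<x} (\<lambda>\<eta>. \<eta>\<^sup>2 * W x y (x - \<eta>) (y + \<eta>))"
    and conv_s: "\<And>i. abs_convergent_average d W 0 1 (\<lambda>\<omega> \<eta>. \<omega> i * \<eta>)"
    and conv_1: "abs_convergent_average d W a b (\<lambda>\<omega> \<eta>. (\<omega> a - \<omega> b) * \<eta>)"
    and conv_2: "abs_convergent_average d W a b (\<lambda>\<omega> \<eta>. \<eta>\<^sup>2)"
  shows "kappa_s_term d W summable_on UNIV \<and>
         kappa_s d W = kappa_1 d W a b \<and> kappa_1 d W a b = kappa_2 d W a b"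
proof -
  have ab: "a \<noteq> b" using neighbours by auto
  \<comment> \<open>The sum \<open>kappa_s\<close> is tied to the bond (0, 1), whereas
    \<open>conv_1\<close> concerns (a, b); subtracting the cases i = 0 and i = 1 of
    \<open>conv_s\<close> gives the condition on (0, 1).\<close>
  have conv: "abs_convergent_average d W 0 1 (\<lambda>\<omega> \<eta>. (\<omega> 0 - \<omega> 1) * \<eta>)"
    using Bochner_Integration.integrable_diff[OF conv_s[of 0, unfolded abs_convergent_average_iff]
        conv_s[of 1, unfolded abs_convergent_average_iff]]
    unfolding abs_convergent_average_iff by (simp add: split_beta' algebra_simps)
  \<comment> \<open>Both sides are half of one and the same Lebesgue integral, in which no site
    occurs.\<close>
  have "kappa_1 d W 0 1 = kappa_1 d W a b"
    using kappa_1_eq(2)[OF kernel _ conv] kappa_1_eq(2)[OF kernel ab conv_1] by simp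
  then show ?thesis
    using kappa_s_eq_kappa_1[OF kernel conv_s] kappa_1_eq_kappa_2[OF kernel ab conv_1 conv_2] by simp
qed

end
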